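(* Let $A\in\mathbb{R}_{\max}^{n\times n}$, $C\in\mathbb{R}_{\max}^{q\times n}$, and let $\mathcal{V}\subset(\mathbb{R}_{\max}^n)^2$ be a congruence. Define a sequence of congruences by $\mathcal{W}_1:=\mathcal{V}$ and $$\mathcal{W}_{k+1}:=\langle \mathcal{V}\oplus A(\mathcal{W}_k\cap\ker C)\rangle\quad(k\ge 1),$$ and let $\mathcal{V}_\infty:=\bigcup_{k\ge 1}\mathcal{W}_k$. Then $\mathcal{V}_\infty$ is the minimal (i.e. smallest) $(C,A)$-conditioned invariant congruence containing $\mathcal{V}$.
   Context: Max-plus semiring: $\mathbb{R}_{\max}=\mathbb{R}\cup\{-\infty\}$ with addition $a\oplus b=\max(a,b)$ and multiplication $ab=a+b$; the zero is $\varepsilon=-\infty$. Operations extend to matrices as usual: $(E\oplus F)_{ij}=E_{ij}\oplus F_{ij}$, $(EF)_{ij}=\bigoplus_k E_{ik}F_{kj}$. A semimodule is a (nonempty) subset of $\mathbb{R}_{\max}^n$ stable under all max-plus linear combinations $\lambda x\oplus\mu y$. A congruence on $\mathbb{R}_{\max}^n$ is an equivalence relation $\mathcal{W}\subset(\mathbb{R}_{\max}^n)^2$ which is also a subsemimodule of $(\mathbb{R}_{\max}^n)^2$. For $\mathcal{U}\subset(\mathbb{R}_{\max}^n)^2$, $\langle\mathcal{U}\rangle$ denotes the smallest congruence containing $\mathcal{U}$. $\ker C=\{(x,y): Cx=Cy\}$; $A\mathcal{W}=\{(Ax,Ay):(x,y)\in\mathcal{W}\}$ for $\mathcal{W}\subset(\mathbb{R}_{\max}^n)^2$;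 the sum of two subsets is $\mathcal{U}\oplus\mathcal{U}'=\{u\oplus u': u\in\mathcal{U},u'\in\mathcal{U}'\}$. A congruence $\mathcal{W}$ is $(C,A)$-conditioned invariant if $A(\mathcal{W}\cap\ker C)\subset\mathcal{W}$. *)

theory Defs
  imports "HOL-Analysis.Finite_Cartesian_Product" "HOL-Library.Extended_Real"
    "HOL-Library.Product_Plus" "HOL-Library.Set_Algebras"
begin

typedef rmax = "{x :: ereal. x \<noteq> \<infinity>}"
  morphisms ereal_of_rmax Abs_rmax
  by (rule exI[of _ 0]) simp

setup_lifting type_definition_rmax

text \<open>
  In this semiring \<open>0\<close> is \<open>-\<infinity>\<close>, \<open>1\<close> is the real number zero, \<open>+\<close> is the maximum and \<open>*\<close> is the
  usual addition. Hence \<open>*v\<close>, \<open>*s\<close> and \<open>+\<close> on vectors and pairs are the max-plus operations,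
  and \<open>+\<close> on sets of pairs is their elementwise max-plus sum.
\<close>

instantiation rmax :: comm_semiring_1
begin

lift_definition zero_rmax :: rmax is "-\<infinity>" by simp

lift_definition one_rmax :: rmax is "0" by simp

lift_definition plus_rmax :: "rmax \<Rightarrow> rmax \<Rightarrow> rmax" is max
  by (simp add: max_def)

lift_definition times_rmax :: "rmax \<Rightarrow> rmax \<Rightarrow> rmax" is "(+)"
  by simp

instance
proof
  fix a b c :: rmax
  show "a * b * c = a * (b * c)" by transfer (simp add: add.assoc)
  show "a * b = b * a" by transfer (simp add: add.commute)
  show "1 * a = a" by transfer simp
  show "a + b + c = a + (b + c)" by transfer (simp add: max.assoc)
  show "a + b = b + a" by transfer (simp add: max.commute)
  show "0 + a = a" by transfer (simp add: max_def)
  show "(a + b) * c = a * c + b * c"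
    by transfer (auto simp: max_def intro!: antisym intro: add_right_mono)
  show "0 * a = 0" by transfer simp
  show "a * 0 = 0" by transfer simp
  show "(0 :: rmax) \<noteq> 1" by transfer simp
qed

end

definition subsemimodule :: "((rmax^'n) \<times> (rmax^'n)) set \<Rightarrow> bool" where
  "subsemimodule W \<longleftrightarrow> W \<noteq> {} \<and>
     (\<forall>a b x y x' y'. (x, y) \<in> W \<longrightarrow> (x', y') \<in> W \<longrightarrow>
        (a *s x + b *s x', a *s y + b *s y') \<in> W)"

definition congruence :: "((rmax^'n) \<times> (rmax^'n)) set \<Rightarrow> bool" where
  "congruence W \<longleftrightarrow> equiv UNIV W \<and> subsemimodule W"

definition generated_congruence ::
    "((rmax^'n) \<times> (rmax^'n)) set \<Rightarrow> ((rmax^'n) \<times> (rmax^'n)) set" where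
  "generated_congruence U = congruence hull U"

definition ker :: "rmax^'n^'q \<Rightarrow> ((rmax^'n) \<times> (rmax^'n)) set" where
  "ker C = {(x, y). C *v x = C *v y}"

definition image_pairs ::
    "rmax^'n^'m \<Rightarrow> ((rmax^'n) \<times> (rmax^'n)) set \<Rightarrow> ((rmax^'m) \<times> (rmax^'m)) set" where
  "image_pairs A W = (\<lambda>(x, y). (A *v x, A *v y)) ` W"

definition conditioned_invariant ::
    "rmax^'n^'q \<Rightarrow> rmax^'n^'n \<Rightarrow> ((rmax^'n) \<times> (rmax^'n)) set \<Rightarrow> bool" where
  "conditioned_invariant C A W \<longleftrightarrow> image_pairs A (W \<inter> ker C) \<subseteq> W"

lemma congruence_Inter:
  assumes "\<And>W. W \<in> F \<Longrightarrow> congruence W"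
  shows "congruence (\<Inter>F)"
proof -
  have e: "equiv UNIV W" "subsemimodule W" if "W \<in> F" for W
    using assms[OF that] by (simp_all add: congruence_def)
  have r: "(x, x) \<in> \<Inter>F" for x
    using e(1) by (auto simp: equiv_def refl_on_def)
  have s: "sym (\<Inter>F)"
    using e(1) by (intro symI) (auto simp: equiv_def dest: symD)
  have t: "trans (\<Inter>F)"
  proof (rule transI)
    fix x y z assume "(x, y) \<in> \<Inter>F" "(y, z) \<in> \<Inter>F"
    then show "(x, z) \<in> \<Inter>F"
      using e(1) unfolding equiv_def by (meson InterE InterI transD)
  qed
  have "subsemimodule (\<Inter>F)"
    using r e(2) unfolding subsemimodule_def by blast
  with r s t show ?thesis
    by (auto simp: congruence_def equiv_def refl_on_def)
qed

lemma generated_congruence_smallest: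
  shows "congruence (generated_congruence U)"
    and "U \<subseteq> generated_congruence U"
    and "congruence W \<Longrightarrow> U \<subseteq> W \<Longrightarrow> generated_congruence U \<subseteq> W"
  unfolding generated_congruence_def
  by (auto intro: hull_in congruence_Inter hull_subset[THEN subsetD]
      dest: hull_minimal[THEN subsetD, rotated 2])

end

theory Submission imports Defs
begin

text \<open>
  The step \<open>U \<mapsto> \<langle>V \<oplus> A(U \<inter> ker C)\<rangle>\<close> is monotone, and both \<open>V\<close> and \<open>A(U \<inter> ker C)\<close> lie in its value
  because \<open>(0, 0)\<close> belongs to every congruence and to the kernel. Hence the sequence increases from
  \<open>V\<close>; its directed union is a congruence, and it is invariant because each step contains the
  \<open>A\<close>-image of the preceding one. Every invariant congruence containing \<open>V\<close> contains every term.
\<close>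

lemma congruence_refl: "congruence W \<Longrightarrow> (x, x) \<in> W"
  by (auto simp: congruence_def equiv_def refl_on_def)

lemma congruence_zero: "congruence W \<Longrightarrow> 0 \<in> W"
  by (simp add: zero_prod_def congruence_refl)

text \<open>Addition is the linear combination with both coefficients equal to \<open>1\<close>, the
  real number zero. This is what lets a congruence absorb elementwise sums of its subsets.\<close>

lemma congruence_add:
  assumes "congruence W" "p \<in> W" "q \<in> W"
  shows "p + q \<in> W"
proof -
  have "(1 *s fst p + 1 *s fst q, 1 *s snd p + 1 *s snd q) \<in> W"
    using assms unfolding congruence_def subsemimodule_def by (metis prod.collapse)
  then show ?thesis
    by (simp add: plus_prod_def)
qed

text \<open>Transitivity and linear combinations each involve only two given pairs, and in an
  increasing chain both already lie in one member, which is closed under the operation. Reflexivity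
  and symmetry hold memberwise.\<close>

lemma congruence_Union_incseq:
  fixes W :: "nat \<Rightarrow> ((rmax^'n) \<times> (rmax^'n)) set"
  assumes cong: "\<And>k. congruence (W k)" and "incseq W"
  shows "congruence (\<Union>k. W k)"
proof -
  have common: "\<exists>k. p \<in> W k \<and> q \<in> W k"
    if "p \<in> (\<Union>k. W k)" "q \<in> (\<Union>k. W k)" for p q
  proof -
    obtain i j where "p \<in> W i" "q \<in> W j"
      using \<open>p \<in> (\<Union>k. W k)\<close> \<open>q \<in> (\<Union>k. W k)\<close> by blast
    then have "p \<in> W (max i j)" "q \<in> W (max i j)"
      using incseqD[OF \<open>incseq W\<close>, of i "max i j"] incseqD[OF \<open>incseq W\<close>, of j "max i j"]
      by auto
    then show ?thesis by blast
  qed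
  have sym: "sym (W k)" and trans: "trans (W k)" and sub: "subsemimodule (W k)" for k
    using cong[of k] by (auto simp: congruence_def equiv_def)
  have "refl (\<Union>k. W k)"
    using congruence_refl[OF cong] by (auto simp: refl_on_def)
  moreover have "sym (\<Union>k. W k)"
    using sym by (intro symI) (auto dest: symD)
  moreover have "trans (\<Union>k. W k)"
  proof (rule transI)
    fix x y z assume "(x, y) \<in> (\<Union>k. W k)" "(y, z) \<in> (\<Union>k. W k)"
    then obtain k where "(x, y) \<in> W k" "(y, z) \<in> W k"
      using common by blast
    then show "(x, z) \<in> (\<Union>k. W k)"
      using transD[OF trans] by blast
  qed
  moreover have "subsemimodule (\<Union>k. W k)"
    unfolding subsemimodule_def
  proof (intro conjI allI impI)
    show "(\<Union>k. W k) \<noteq> {}"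
      using congruence_zero[OF cong] by blast
  next
    fix a b :: rmax and x y x' y' :: "rmax^'n"
    assume "(x, y) \<in> (\<Union>k. W k)" "(x', y') \<in> (\<Union>k. W k)"
    then obtain k where "(x, y) \<in> W k" "(x', y') \<in> W k"
      using common by blast
    then show "(a *s x + b *s x', a *s y + b *s y') \<in> (\<Union>k. W k)"
      using sub[of k] unfolding subsemimodule_def by blast
  qed
  ultimately show ?thesis
    by (auto simp: congruence_def equiv_def)
qed

lemma image_pairs_mono: "U \<subseteq> U' \<Longrightarrow> image_pairs A U \<subseteq> image_pairs A U'"
  unfolding image_pairs_def by (rule image_mono)

lemma zero_in_image_pairs: "0 \<in> U \<Longrightarrow> 0 \<in> image_pairs A U"
  unfolding image_pairs_def
  by (rule image_eqI[of _ _ 0]) (simp_all add: zero_prod_def matrix_vector_mult_def vec_eq_iff)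

lemma zero_in_ker: "0 \<in> ker C"
  by (simp add: ker_def zero_prod_def)

lemma generated_congruence_mono:
  "U \<subseteq> U' \<Longrightarrow> generated_congruence U \<subseteq> generated_congruence U'"
  unfolding generated_congruence_def by (rule hull_mono)

theorem proposition2:
  fixes A :: "rmax^'n^'n"
    and C :: "rmax^'n^'q"
    and V :: "((rmax^'n) \<times> (rmax^'n)) set"
    and W :: "nat \<Rightarrow> ((rmax^'n) \<times> (rmax^'n)) set"
    and Vinf :: "((rmax^'n) \<times> (rmax^'n)) set"
  assumes "congruence V"
    and "W 1 = V"
    and "\<And>k. k \<ge> 1 \<Longrightarrow> W (k + 1) = generated_congruence (V + image_pairs A (W k \<inter> ker C))"
    and "Vinf = (\<Union>k\<in>{1..}. W k)"
  shows "congruence Vinf \<and> conditioned_invariant C A Vinf \<and> V \<subseteq> Vinf \<and>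
    (\<forall>X. congruence X \<and> conditioned_invariant C A X \<and> V \<subseteq> X \<longrightarrow> Vinf \<subseteq> X)"
proof -
  \<comment> \<open>The hypotheses say nothing about \<open>W 0\<close>; the shift makes the
    sequence start at index 0, so that induction on \<open>nat\<close> and \<open>incseq\<close>
    apply directly.\<close>
  define U where "U k = W (Suc k)" for k
  have U_0: "U 0 = V"
    using assms(2) by (simp add: U_def)
  have U_Suc: "U (Suc k) = generated_congruence (V + image_pairs A (U k \<inter> ker C))" for k
    using assms(3)[of "Suc k"] by (simp add: U_def)
  have Vinf: "Vinf = (\<Union>k. U k)"
    unfolding assms(4) U_def
    by (auto simp: Suc_le_eq gr0_conv_Suc)
  \<comment> \<open>A case split suffices: every later term is a generated congruence, whatever its
    predecessor is.\<close>
  have cong: "congruence (U k)" for k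
    by (cases k) (simp_all add: U_0 U_Suc assms(1) generated_congruence_smallest(1))
  have V_le: "V \<subseteq> U (Suc k)" for k
  proof -
    \<comment> \<open>Each \<open>v\<close> in \<open>V\<close> is written as \<open>v + 0\<close>,
      with the summand \<open>0\<close> taken from the image.\<close>
    have "0 \<in> image_pairs A (U k \<inter> ker C)"
      by (simp add: zero_in_image_pairs zero_in_ker congruence_zero cong)
    then have "V \<subseteq> V + image_pairs A (U k \<inter> ker C)"
      using set_zero_plus2[of "image_pairs A (U k \<inter> ker C)" V] by (simp add: add.commute)
    then show ?thesis
      unfolding U_Suc using generated_congruence_smallest(2) by (rule subset_trans)
  qed
  \<comment> \<open>Here the roles are exchanged: the summand \<open>0\<close> comes from
    \<open>V\<close>.\<close>
  have image_le: "image_pairs A (U k \<inter> ker C) \<subseteq> U (Suc k)" for k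
    unfolding U_Suc
    using set_zero_plus2[OF congruence_zero[OF assms(1)]] generated_congruence_smallest(2)
    by (rule subset_trans)
  \<comment> \<open>The base case is \<open>V_le\<close>; applying the monotone step map to both
    sides of an inclusion yields the next one.\<close>
  have "U k \<subseteq> U (Suc k)" for k
  proof (induction k)
    case 0
    show ?case using V_le U_0 by simp
  next
    case (Suc k)
    then have "U k \<inter> ker C \<subseteq> U (Suc k) \<inter> ker C"
      by blast
    then have "generated_congruence (V + image_pairs A (U k \<inter> ker C))
        \<subseteq> generated_congruence (V + image_pairs A (U (Suc k) \<inter> ker C))"
      by (intro generated_congruence_mono set_plus_mono2 image_pairs_mono subset_refl)
    then show ?case
      by (simp only: U_Suc[symmetric])
  qed
  then have "incseq U"
    by (rule incseq_SucI)
  then have "congruence Vinf"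
    unfolding Vinf using cong by (rule congruence_Union_incseq[rotated])
  moreover have "conditioned_invariant C A Vinf"
    unfolding conditioned_invariant_def
  proof
    fix p assume "p \<in> image_pairs A (Vinf \<inter> ker C)"
    \<comment> \<open>The image is taken pair by pair, so the preimage of \<open>p\<close> already
      lies in a single \<open>U k\<close>, and \<open>image_le\<close> places \<open>p\<close> in
      \<open>U (Suc k)\<close>.\<close>
    then obtain k where "p \<in> image_pairs A (U k \<inter> ker C)"
      unfolding Vinf image_pairs_def by blast
    then show "p \<in> Vinf"
      using image_le unfolding Vinf by blast
  qed
  moreover have "V \<subseteq> Vinf"
    using U_0 unfolding Vinf by blast
  moreover have "Vinf \<subseteq> X"
    if X: "congruence X" "conditioned_invariant C A X" "V \<subseteq> X" for X
  proof -
    \<comment> \<open>Invariance of \<open>X\<close> absorbs the image of \<open>U k\<close>,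
      closure under addition absorbs the sum with \<open>V\<close>, and minimality of the generated
      congruence absorbs the closure.\<close>
    have "U k \<subseteq> X" for k
    proof (induction k)
      case 0
      show ?case using X(3) U_0 by simp
    next
      case (Suc k)
      then have "image_pairs A (U k \<inter> ker C) \<subseteq> X"
        using X(2) image_pairs_mono[of "U k \<inter> ker C" "X \<inter> ker C"]
        unfolding conditioned_invariant_def by blast
      then have "V + image_pairs A (U k \<inter> ker C) \<subseteq> X + X"
        using X(3) by (rule set_plus_mono2[rotated])
      also have "X + X \<subseteq> X"
        by (rule subsetI, elim set_plus_elim) (simp only: congruence_add[OF X(1)])
      finally have "V + image_pairs A (U k \<inter> ker C) \<subseteq> X" .
      then show ?case
        unfolding U_Suc by (rule generated_congruence_smallest(3)[OF X(1)])
    qed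
    then show ?thesis
      unfolding Vinf by blast
  qed
  ultimately show ?thesis
    by blast
qed

end
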